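(* Let $C_n$ be a cycle graph over the vertex set $V=\{x_1,x_2,\dots,x_n\}$ and let $2\leq t\leq n$ be an integer. Write $n=tq+r$ with $r\in\{0,1,\dots,t-1\}$, and let $I=I_t(C_n)\subseteq k[x_1,\dots,x_n]$ be the $t$-path ideal of $C_n$ over a field $k$. Then $$\widehat{\alpha}(I)=\begin{cases} t & \text{if } r=0,\\[2pt] \dfrac{n}{q+1} & \text{if } r\neq 0.\end{cases}$$
   Context: The cycle $C_n$ on $\{x_1,\dots,x_n\}$ has edges $\{x_i,x_{i+1}\}$ for $1\le i\le n$, indices taken modulo $n$. For a simple graph $G=(V,E)$, a path is a sequence of distinct vertices $v_1,\dots,v_s$ with $\{v_i,v_{i+1}\}$ an edge for each $1\le i<s$. The $t$-path ideal $I_t(G)$ is the ideal of $k[V]$ (vertices identified with variables) generated by the monomials $x_{i_1}x_{i_2}\cdots x_{i_t}$ such that $x_{i_1},x_{i_2},\dots,x_{i_t}$ is a path in $G$. For an ideal $I$ in a Noetherian domain $R$, the $n$-th symbolic power is $I^{(n)}=\bigcap_{\mathfrak{p}\in \mathrm{Ass}_R(R/I)}(I^nR_{\mathfrak{p}}\cap R)$. For a nonzero homogeneous ideal $I$, $\alpha(I)=\min\{d: I_d\neq 0\}$ is the least degree of a nonzero homogeneous element of $I$, and the Waldschmidt constant is $\widehat{\alpha}(I)=\lim_{m\to\infty}\alpha(I^{(m)})/m$. *)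

theory Defs
  imports
    Complex_Main
    "HOL-Library.Poly_Mapping"
    "HOL-Computational_Algebra.Fraction_Field"
begin

section \<open>Ideals and symbolic powers in a domain\<close>

text \<open>
  Ideals of a commutative ring are its submodules, so the library's \<^locale>\<open>module\<close> applied to
  the ring as a module over itself supplies ideals and generated ideals.
\<close>

global_interpretation ring_module: module "(*) :: 'a::comm_ring_1 \<Rightarrow> 'a \<Rightarrow> 'a"
  by unfold_locales (simp_all add: algebra_simps)

abbreviation is_ideal :: "'a::comm_ring_1 set \<Rightarrow> bool" where
  "is_ideal \<equiv> module.subspace (*)"

abbreviation ideal_gen :: "'a::comm_ring_1 set \<Rightarrow> 'a set" where
  "ideal_gen \<equiv> module.span (*)"

definition prime_ideal :: "'a::comm_ring_1 set \<Rightarrow> bool" where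
  "prime_ideal P \<longleftrightarrow> is_ideal P \<and> P \<noteq> UNIV \<and> (\<forall>a b. a * b \<in> P \<longrightarrow> a \<in> P \<or> b \<in> P)"

definition ideal_power :: "'a::comm_ring_1 set \<Rightarrow> nat \<Rightarrow> 'a set" where
  "ideal_power I m = ideal_gen {\<Prod>i<m. f i | f. \<forall>i<m. f i \<in> I}"

text \<open>
  The set \<open>{a. a * b \<in> I}\<close> is the annihilator of the class of \<open>b\<close> in the module \<open>R/I\<close>.
\<close>

definition Ass :: "'a::comm_ring_1 set \<Rightarrow> 'a set set" where
  "Ass I = {P. prime_ideal P \<and> (\<exists>b. P = {a. a * b \<in> I})}"

text \<open>For a domain \<open>R\<close>, the localisation at \<open>P\<close> is taken inside the fraction field of \<open>R\<close>.\<close>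

definition localization :: "'a::idom set \<Rightarrow> 'a fract set" where
  "localization P = {Fract a s | a s. s \<notin> P}"

text \<open>The ideal \<open>J R\<^sub>P\<close> of \<open>R\<^sub>P\<close>, consisting of the \<open>R\<^sub>P\<close>-linear combinations of elements of \<open>J\<close>.\<close>

definition extended_ideal :: "'a::idom set \<Rightarrow> 'a set \<Rightarrow> 'a fract set" where
  "extended_ideal J P =
     {\<Sum>i<k. c i * Fract (a i) 1 | (k::nat) c a. \<forall>i<k. c i \<in> localization P \<and> a i \<in> J}"

definition symbolic_power :: "'a::idom set \<Rightarrow> nat \<Rightarrow> 'a set" where
  "symbolic_power I m =
     (\<Inter>P\<in>Ass I. {f. Fract f 1 \<in> extended_ideal (ideal_power I m) P})"

section \<open>Polynomial rings and the Waldschmidt constant\<close>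

text \<open>
  The polynomial ring \<open>k[V]\<close> whose variables are the elements of the type \<open>'v\<close>: finitely supported
  maps from exponent vectors to coefficients, multiplied by convolution. The library makes it an
  \<^class>\<open>idom\<close> only when \<open>'v\<close> is linearly ordered.
\<close>

type_synonym ('v, 'k) mpoly = "('v \<Rightarrow>\<^sub>0 nat) \<Rightarrow>\<^sub>0 'k"

definition var :: "'v \<Rightarrow> ('v, 'k::comm_ring_1) mpoly" where
  "var v = Poly_Mapping.single (Poly_Mapping.single v 1) 1"

definition monom_degree :: "('v \<Rightarrow>\<^sub>0 nat) \<Rightarrow> nat" where
  "monom_degree m = (\<Sum>v\<in>Poly_Mapping.keys m. Poly_Mapping.lookup m v)"

definition homogeneous :: "nat \<Rightarrow> ('v, 'k::comm_ring_1) mpoly \<Rightarrow> bool" where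
  "homogeneous d f \<longleftrightarrow> (\<forall>m\<in>Poly_Mapping.keys f. monom_degree m = d)"

text \<open>Meaningful only if \<open>I\<close> contains a nonzero homogeneous element.\<close>

definition initial_degree :: "('v, 'k::comm_ring_1) mpoly set \<Rightarrow> nat" where
  "initial_degree I = (LEAST d. \<exists>f\<in>I. f \<noteq> 0 \<and> homogeneous d f)"

definition waldschmidt_seq :: "('v::linorder, 'k::field) mpoly set \<Rightarrow> nat \<Rightarrow> real" where
  "waldschmidt_seq I m = real (initial_degree (symbolic_power I m)) / real m"

text \<open>\<^const>\<open>lim\<close> is unspecified for a divergent sequence, so statements should also assert
  convergence of \<^const>\<open>waldschmidt_seq\<close>.\<close>

definition waldschmidt_constant :: "('v::linorder, 'k::field) mpoly set \<Rightarrow> real" where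
  "waldschmidt_constant I = lim (waldschmidt_seq I)"

section \<open>Path ideals of graphs\<close>

text \<open>
  A simple graph on the vertex set \<open>UNIV :: 'v set\<close> is given by its set of edges, each of them
  an unordered pair of vertices.
\<close>

definition is_path :: "'v set set \<Rightarrow> 'v list \<Rightarrow> bool" where
  "is_path E vs \<longleftrightarrow> distinct vs \<and> successively (\<lambda>u v. {u, v} \<in> E) vs"

definition path_ideal :: "nat \<Rightarrow> 'v set set \<Rightarrow> ('v, 'k::field) mpoly set" where
  "path_ideal t E = ideal_gen {prod_list (map var vs) | vs. is_path E vs \<and> length vs = t}"

text \<open>The successor of \<open>i\<close> in \<open>{1..n}\<close> modulo \<open>n\<close> is \<open>i mod n + 1\<close>.\<close>

definition cycle_edges :: "nat \<Rightarrow> (nat \<Rightarrow> 'v) \<Rightarrow> 'v set set" where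
  "cycle_edges n x = {{x i, x (i mod n + 1)} | i. i \<in> {1..n}}"

end

theory Submission
  imports Defs "HOL-Library.Cardinality"
begin

text \<open>
  The \<open>t\<close>-paths of the cycle are its arcs of \<open>t\<close> consecutive vertices, so \<open>I\<close> is the squarefree
  monomial ideal of the hypergraph of arcs and its associated primes come from the minimal covers.
  Put \<open>c = \<lceil>n/t\<rceil>\<close>. A cover meets all \<open>n\<close> arcs and each vertex lies on \<open>t\<close> of them, so every cover has
  at least \<open>c\<close> vertices; hence \<open>(x\<^sub>1 \<cdots> x\<^sub>n)\<^sup>k\<close> lies in the symbolic power \<open>I\<^bsup>(c k)\<^esup>\<close>. Conversely, a
  monomial in \<open>I\<^bsup>(m)\<^esup>\<close> has degree at least \<open>m\<close> in the variables of any cover; averaging this over the \<open>n\<close>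
  rotations of the cover \<open>{0, t, \<dots>, (c - 1) t}\<close> bounds its total degree below by \<open>n m / c\<close>.
\<close>

section \<open>Associated primes and symbolic powers\<close>

lemma prime_ideal_prod:
  assumes "prime_ideal P" "finite A" "\<And>i. i \<in> A \<Longrightarrow> f i \<notin> P"
  shows "(\<Prod>i\<in>A. f i) \<notin> P"
  using assms(2,3)
proof (induction A rule: finite_induct)
  case empty
  have "1 \<notin> P"
  proof
    assume "1 \<in> P"
    then have "x * 1 \<in> P" for x
      using assms(1) ring_module.subspace_scale unfolding prime_ideal_def by blast
    then show False
      using assms(1) unfolding prime_ideal_def by auto
  qed
  then show ?case by simp
next
  case (insert i A)
  then show ?case
    using assms(1) unfolding prime_ideal_def by auto
qed

lemma prime_ideal_power:
  assumes "prime_ideal P" "a \<notin> P"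
  shows "a ^ n \<notin> P"
  using prime_ideal_prod[of P "{..<n}" "\<lambda>_. a"] assms by simp

text \<open>Clearing denominators: the denominators of the finitely many coefficients lie outside
  \<open>P\<close>, and so does their product because \<open>P\<close> is prime. Conversely,
  \<open>f = (1/s) * (s * f)\<close> is a combination with a single term.\<close>

lemma Fract_mem_extended_ideal_iff:
  assumes P: "prime_ideal P" and J: "is_ideal J"
  shows "Fract f 1 \<in> extended_ideal J P \<longleftrightarrow> (\<exists>s. s \<notin> P \<and> s * f \<in> J)"
proof
  have zero: "0 \<in> P"
    using P ring_module.subspace_0 unfolding prime_ideal_def by blast
  have common_denominator: "\<exists>g s. s \<notin> P \<and> g \<in> J \<and> (\<Sum>i<k. c i * Fract (a i) 1) = Fract g s"
    if "\<forall>i<k. c i \<in> localization P \<and> a i \<in> J" for k :: nat and c a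
    using that
  proof (induction k)
    case 0
    have "1 \<notin> P" using prime_ideal_power[OF P, of _ 0] P unfolding prime_ideal_def by auto
    then show ?case
      using ring_module.subspace_0[OF J] by (intro exI[of _ 0] exI[of _ 1]) (simp add: Zero_fract_def)
  next
    case (Suc k)
    obtain g s where gs: "s \<notin> P" "g \<in> J" "(\<Sum>i<k. c i * Fract (a i) 1) = Fract g s"
      using Suc by fastforce
    obtain b u where bu: "c k = Fract b u" "u \<notin> P"
      using Suc.prems unfolding localization_def by blast
    have nz: "s \<noteq> 0" "u \<noteq> 0" using gs bu zero by auto
    have "(\<Sum>i<Suc k. c i * Fract (a i) 1) = Fract (g * u + b * a k * s) (s * u)"
      by (simp only: sum.lessThan_Suc gs(3) bu(1) mult_fract mult_1_right add_fract[OF nz])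
    moreover have "g * u + b * a k * s = u * g + (s * b) * a k"
      by (simp only: ac_simps)
    moreover have "u * g + (s * b) * a k \<in> J"
      using J gs(2) Suc.prems by (intro ring_module.subspace_add ring_module.subspace_scale) auto
    moreover have "s * u \<notin> P" using P gs bu unfolding prime_ideal_def by blast
    ultimately show ?case by (intro exI conjI) auto
  qed
  assume "Fract f 1 \<in> extended_ideal J P"
  then obtain k :: nat and c a where sum: "Fract f 1 = (\<Sum>i<k. c i * Fract (a i) 1)"
    and mem: "\<forall>i<k. c i \<in> localization P \<and> a i \<in> J"
    unfolding extended_ideal_def by blast
  obtain g s where gs: "s \<notin> P" "g \<in> J" "(\<Sum>i<k. c i * Fract (a i) 1) = Fract g s"
    using common_denominator[OF mem] by blast
  have "s \<noteq> 0" using gs(1) zero by auto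
  then have "s * f = g"
    using sum gs(3) by (simp add: eq_fract(1) mult.commute)
  then show "\<exists>s. s \<notin> P \<and> s * f \<in> J"
    using gs by blast
next
  assume "\<exists>s. s \<notin> P \<and> s * f \<in> J"
  then obtain s where s: "s \<notin> P" "s * f \<in> J" by blast
  have "s \<noteq> 0"
    using P s ring_module.subspace_0 unfolding prime_ideal_def by blast
  then have "Fract f 1 = Fract 1 s * Fract (s * f) 1"
    unfolding mult_fract by (simp only: eq_fract(1) mult_1_left mult_1_right mult_eq_0_iff
        one_neq_zero simp_thms mult.commute)
  then have eq: "Fract f 1 = (\<Sum>i<(1::nat). Fract 1 s * Fract (s * f) 1)"
    by (simp only: sum.lessThan_Suc One_nat_def lessThan_0 sum.empty add_0_left)
  have loc: "Fract 1 s \<in> localization P" using s unfolding localization_def by blast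
  show "Fract f 1 \<in> extended_ideal J P"
    unfolding extended_ideal_def mem_Collect_eq
    by (rule exI[of _ 1], rule exI[of _ "\<lambda>_. Fract 1 s"], rule exI[of _ "\<lambda>_. s * f"],
        rule conjI, rule eq) (use loc s(2) in blast)
qed

lemma mem_symbolic_power_iff:
  "f \<in> symbolic_power I m \<longleftrightarrow> (\<forall>P\<in>Ass I. \<exists>s. s \<notin> P \<and> s * f \<in> ideal_power I m)"
proof -
  have "is_ideal (ideal_power I m)" unfolding ideal_power_def by simp
  then have "Fract f 1 \<in> extended_ideal (ideal_power I m) P
      \<longleftrightarrow> (\<exists>s. s \<notin> P \<and> s * f \<in> ideal_power I m)" if "P \<in> Ass I" for P
    using that Fract_mem_extended_ideal_iff unfolding Ass_def by blast
  then show ?thesis unfolding symbolic_power_def by simp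
qed

text \<open>Any \<open>m\<close> of the factors already form a generator of the power; the remaining
  ones act as scalars.\<close>

lemma prod_mem_ideal_power:
  assumes "is_ideal I" "finite A" "\<And>i. i \<in> A \<Longrightarrow> f i \<in> I" "m \<le> card A"
  shows "(\<Prod>i\<in>A. f i) \<in> ideal_power I m"
proof -
  obtain B where B: "B \<subseteq> A" "card B = m" "finite B"
    using assms(2,4) obtain_subset_with_card_n by metis
  obtain h where h: "bij_betw h {..<m} B"
    using ex_bij_betw_nat_finite[OF B(3)] B(2) atLeast0LessThan by metis
  have "(\<Prod>i\<in>B. f i) = (\<Prod>i<m. f (h i))"
    using prod.reindex_bij_betw[OF h, of f] by simp
  moreover have "f (h i) \<in> I" if "i < m" for i
    using assms(3) B(1) bij_betwE[OF h] that by blast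
  ultimately have "(\<Prod>i\<in>B. f i) \<in> ideal_power I m"
    unfolding ideal_power_def
    by (intro ring_module.span_base) (auto intro!: exI[of _ "\<lambda>i. f (h i)"])
  moreover have "(\<Prod>i\<in>A. f i) = (\<Prod>i\<in>A - B. f i) * (\<Prod>i\<in>B. f i)"
    using prod.subset_diff[OF B(1) assms(2)] .
  ultimately show ?thesis
    unfolding ideal_power_def by (simp only: ring_module.span_scale)
qed

section \<open>Monomial valuations\<close>

definition monomial_weight :: "'v set \<Rightarrow> ('v \<Rightarrow>\<^sub>0 nat) \<Rightarrow> nat" where
  "monomial_weight C u = (\<Sum>v\<in>C. Poly_Mapping.lookup u v)"

text \<open>The \<open>m\<close>-th power of the prime generated by the variables in \<open>C\<close>, described by its monomials.\<close>

definition weight_ideal :: "'v set \<Rightarrow> nat \<Rightarrow> ('v, 'k::comm_ring_1) mpoly set" where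
  "weight_ideal C m = {f. \<forall>u\<in>Poly_Mapping.keys f. m \<le> monomial_weight C u}"

lemma monomial_weight_add: "monomial_weight C (u + w) = monomial_weight C u + monomial_weight C w"
  by (simp add: monomial_weight_def lookup_add sum.distrib)

lemma weight_ideal_mult:
  assumes "f \<in> weight_ideal C a" "g \<in> weight_ideal C b"
  shows "f * g \<in> weight_ideal C (a + b)"
  using assms keys_mult[of f g] unfolding weight_ideal_def
  by (fastforce simp: monomial_weight_add intro: add_mono)

lemma is_ideal_weight_ideal: "is_ideal (weight_ideal C m)"
proof (rule ring_module.subspaceI)
  show "f + g \<in> weight_ideal C m" if "f \<in> weight_ideal C m" "g \<in> weight_ideal C m"
    for f g :: "('a, 'b) mpoly"
    using that Poly_Mapping.keys_add[of f g] unfolding weight_ideal_def by blast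
  show "c * f \<in> weight_ideal C m" if "f \<in> weight_ideal C m" for c f :: "('a, 'b) mpoly"
    \<comment> \<open>\<open>weight_ideal C 0\<close> is the whole ring, so closure under scalars is
      the product rule with weight 0 on the left.\<close>
    using that weight_ideal_mult[of c C 0 f m] by (simp add: weight_ideal_def)
qed (simp add: weight_ideal_def)

lemma weight_ideal_mono: "m' \<le> m \<Longrightarrow> weight_ideal C m \<subseteq> weight_ideal C m'"
  unfolding weight_ideal_def by fastforce

text \<open>Written as a finite sum of monomials, so that it splits off forms of a given weight and,
  for \<open>A = UNIV\<close>, yields the expansion of \<open>f\<close> into its monomials.\<close>

definition restrict_keys :: "('a \<Rightarrow>\<^sub>0 'b::comm_monoid_add) \<Rightarrow> 'a set \<Rightarrow> 'a \<Rightarrow>\<^sub>0 'b" where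
  "restrict_keys f A =
     (\<Sum>u\<in>Poly_Mapping.keys f \<inter> A. Poly_Mapping.single u (Poly_Mapping.lookup f u))"

lemma lookup_restrict_keys:
  "Poly_Mapping.lookup (restrict_keys f A) u = (if u \<in> A then Poly_Mapping.lookup f u else 0)"
proof -
  have "Poly_Mapping.lookup (restrict_keys f A) u =
      (\<Sum>w\<in>Poly_Mapping.keys f \<inter> A. if w = u then Poly_Mapping.lookup f u else 0)"
    unfolding restrict_keys_def lookup_sum
    by (intro sum.cong) (auto simp: lookup_single when_def)
  also have "\<dots> = (if u \<in> A then Poly_Mapping.lookup f u else 0)"
    by (auto simp: sum.delta in_keys_iff)
  finally show ?thesis .
qed

lemma sum_single_keys:
  "(\<Sum>u\<in>Poly_Mapping.keys f. Poly_Mapping.single u (Poly_Mapping.lookup f u)) = f"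
proof (rule poly_mapping_eqI)
  fix u
  show "Poly_Mapping.lookup (\<Sum>u\<in>Poly_Mapping.keys f.
      Poly_Mapping.single u (Poly_Mapping.lookup f u)) u = Poly_Mapping.lookup f u"
    using lookup_restrict_keys[of f UNIV u] by (simp add: restrict_keys_def)
qed

text \<open>Split by \<open>d\<close>, the least weight on \<open>C\<close> among the monomials of
  \<open>f\<close>; some monomial has weight at most \<open>a\<close>, whence
  \<open>d \<le> a\<close>.\<close>

lemma weight_ideal_leading_form:
  assumes "f \<notin> weight_ideal C (Suc a)"
  obtains f0 f1 d where "f = f0 + f1" "f0 \<noteq> 0" "d \<le> a"
    "\<And>u. u \<in> Poly_Mapping.keys f0 \<Longrightarrow> monomial_weight C u = d"
    "f1 \<in> weight_ideal C (Suc d)"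
proof -
  define d where "d = (LEAST d. \<exists>u\<in>Poly_Mapping.keys f. monomial_weight C u = d)"
  obtain w where w: "w \<in> Poly_Mapping.keys f" "monomial_weight C w \<le> a"
    using assms unfolding weight_ideal_def by force
  obtain w' where w': "w' \<in> Poly_Mapping.keys f" "monomial_weight C w' = d"
    using LeastI[of "\<lambda>d. \<exists>u\<in>Poly_Mapping.keys f. monomial_weight C u = d"] w(1)
    unfolding d_def by blast
  have least: "d \<le> monomial_weight C u" if "u \<in> Poly_Mapping.keys f" for u
    unfolding d_def by (rule Least_le) (use that in blast)
  define f0 where "f0 = restrict_keys f {u. monomial_weight C u = d}"
  define f1 where "f1 = restrict_keys f {u. monomial_weight C u \<noteq> d}"
  show thesis
  proof (rule that[of f0 f1 d])
    show "f = f0 + f1"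
      by (rule poly_mapping_eqI) (simp add: lookup_add f0_def f1_def lookup_restrict_keys)
    have "Poly_Mapping.lookup f0 w' \<noteq> 0"
      using w' by (simp add: f0_def lookup_restrict_keys in_keys_iff)
    then show "f0 \<noteq> 0" by auto
    show "d \<le> a" using least[OF w(1)] w(2) by simp
    show "monomial_weight C u = d" if "u \<in> Poly_Mapping.keys f0" for u
      using that by (auto simp: f0_def lookup_restrict_keys in_keys_iff split: if_splits)
    show "f1 \<in> weight_ideal C (Suc d)"
      using least by (fastforce simp: weight_ideal_def f1_def lookup_restrict_keys in_keys_iff
          split: if_splits)
  qed
qed

text \<open>The lowest-weight forms of two polynomials multiply to a nonzero form, so the weight is a
  valuation and not merely submultiplicative.\<close>

lemma mult_notin_weight_ideal:
  fixes f g :: "('v::linorder, 'k::idom) mpoly"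
  assumes "f \<notin> weight_ideal C (Suc a)" "g \<notin> weight_ideal C (Suc b)"
  shows "f * g \<notin> weight_ideal C (Suc (a + b))"
proof
  assume fg: "f * g \<in> weight_ideal C (Suc (a + b))"
  obtain f0 f1 d where f: "f = f0 + f1" "f0 \<noteq> 0" "d \<le> a"
    "\<And>u. u \<in> Poly_Mapping.keys f0 \<Longrightarrow> monomial_weight C u = d"
    "f1 \<in> weight_ideal C (Suc d)"
    using weight_ideal_leading_form[OF assms(1)] by blast
  obtain g0 g1 e where g: "g = g0 + g1" "g0 \<noteq> 0" "e \<le> b"
    "\<And>u. u \<in> Poly_Mapping.keys g0 \<Longrightarrow> monomial_weight C u = e"
    "g1 \<in> weight_ideal C (Suc e)"
    using weight_ideal_leading_form[OF assms(2)] by blast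
  have "f0 \<in> weight_ideal C d" "g0 \<in> weight_ideal C e"
    using f(4) g(4) by (auto simp: weight_ideal_def)
  moreover have "g1 \<in> weight_ideal C e"
    using g(5) weight_ideal_mono[of e "Suc e" C] by auto
  ultimately have in_ideal: "f0 \<in> weight_ideal C d" "g \<in> weight_ideal C e"
    using is_ideal_weight_ideal[of C e] by (auto simp: g(1) intro: ring_module.subspace_add)
  have "f0 * g1 \<in> weight_ideal C (Suc (d + e))" "f1 * g \<in> weight_ideal C (Suc (d + e))"
    using weight_ideal_mult[OF in_ideal(1) g(5)] weight_ideal_mult[OF f(5) in_ideal(2)] by simp_all
  moreover have "f * g \<in> weight_ideal C (Suc (d + e))"
    using fg weight_ideal_mono[of "Suc (d + e)" "Suc (a + b)" C] f(3) g(3) by auto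
  \<comment> \<open>The two cross terms have weight above \<open>d + e\<close>, so the same would
    hold for \<open>f0 * g0\<close>, whose monomials all have weight exactly
    \<open>d + e\<close>.\<close>
  ultimately have "f * g - (f0 * g1 + f1 * g) \<in> weight_ideal C (Suc (d + e))"
    using is_ideal_weight_ideal by (intro ring_module.subspace_diff ring_module.subspace_add)
  moreover have "f * g - (f0 * g1 + f1 * g) = f0 * g0"
    using f(1) g(1) by (simp add: algebra_simps)
  ultimately have form: "f0 * g0 \<in> weight_ideal C (Suc (d + e))" by simp
  have "f0 * g0 \<noteq> 0" using f(2) g(2) by simp
  then obtain u where u: "u \<in> Poly_Mapping.keys (f0 * g0)"
    by (metis all_not_in_conv keys_eq_empty)
  then have "monomial_weight C u = d + e"
    using keys_mult[of f0 g0] f(4) g(4) by (fastforce simp: monomial_weight_add)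
  then show False using form u unfolding weight_ideal_def by fastforce
qed

text \<open>The case \<open>a = b = 0\<close> of the valuation property; the ideal is proper because
  the monomial 1 has weight 0.\<close>

lemma prime_ideal_weight_ideal:
  "prime_ideal (weight_ideal C 1 :: ('v::linorder, 'k::idom) mpoly set)"
proof -
  have "(1 :: ('v, 'k) mpoly) \<notin> weight_ideal C 1"
    by (simp add: weight_ideal_def monomial_weight_def)
  then show ?thesis
    using mult_notin_weight_ideal[of _ C 0 _ 0] is_ideal_weight_ideal
    unfolding prime_ideal_def by fastforce
qed

lemma ideal_power_subset_weight_ideal:
  assumes "I \<subseteq> weight_ideal C 1"
  shows "ideal_power I m \<subseteq> weight_ideal C m"
  unfolding ideal_power_def
proof (rule ring_module.span_minimal[OF _ is_ideal_weight_ideal], safe)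
  fix f :: "nat \<Rightarrow> ('a, 'b) mpoly"
  assume "\<forall>i<m. f i \<in> I"
  then show "(\<Prod>i<m. f i) \<in> weight_ideal C m"
  proof (induction m)
    case 0
    then show ?case by (simp add: weight_ideal_def)
  next
    case (Suc m)
    then show ?case
      using weight_ideal_mult[of "\<Prod>i<m. f i" C m "f m" 1] assms by (auto simp: mult.commute)
  qed
qed

section \<open>Squarefree monomial ideals\<close>

text \<open>The edge ideal of a hypergraph. Indexing generators by vertex sets forgets the order
  along a path, so both directions of a path give the same generator.\<close>

definition edge_ideal :: "'v set set \<Rightarrow> ('v, 'k::comm_ring_1) mpoly set" where
  "edge_ideal H = ideal_gen ((\<lambda>S. \<Prod>v\<in>S. var v) ` H)"

definition is_cover :: "'v set set \<Rightarrow> 'v set \<Rightarrow> bool" where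
  "is_cover H C \<longleftrightarrow> (\<forall>S\<in>H. S \<inter> C \<noteq> {})"

lemma is_ideal_edge_ideal: "is_ideal (edge_ideal H)"
  by (simp add: edge_ideal_def)

lemma prod_var:
  "(\<Prod>v\<in>S. var v) = Poly_Mapping.single (\<Sum>v\<in>S. Poly_Mapping.single v 1) 1"
  by (induction S rule: infinite_finite_induct) (simp_all add: var_def mult_single)

lemma lookup_sum_single:
  fixes S :: "'v::finite set"
  shows "Poly_Mapping.lookup (\<Sum>v\<in>S. Poly_Mapping.single v (1::nat)) w = (if w \<in> S then 1 else 0)"
  by (simp add: lookup_sum lookup_single when_def)

text \<open>The exponent vector of the product is the indicator of \<open>S\<close>, whose weight on
  \<open>C\<close> is \<open>card (C \<inter> S)\<close>.\<close>

lemma prod_var_mem_weight_ideal_iff: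
  fixes S C :: "'v::finite set"
  shows "((\<Prod>v\<in>S. var v) :: ('v, 'k::comm_ring_1) mpoly) \<in> weight_ideal C 1 \<longleftrightarrow> S \<inter> C \<noteq> {}"
proof -
  have "monomial_weight C (\<Sum>v\<in>S. Poly_Mapping.single v 1) = card (C \<inter> S)"
    unfolding monomial_weight_def lookup_sum_single
    by (simp add: sum.If_cases)
  then show ?thesis
    by (auto simp: prod_var weight_ideal_def Suc_le_eq card_gt_0_iff)
qed

lemma single_mem_edge_ideal:
  fixes S :: "'v::finite set"
  assumes "S \<in> H" "S \<subseteq> Poly_Mapping.keys u"
  shows "(Poly_Mapping.single u c :: ('v, 'k::comm_ring_1) mpoly) \<in> edge_ideal H"
proof -
  define e where "e = (\<Sum>v\<in>S. Poly_Mapping.single v (1::nat))"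
  \<comment> \<open>The pointwise subtraction does not truncate, since \<open>u\<close> is at least
    1 on all of \<open>S\<close>.\<close>
  have "(u - e) + e = u"
  proof (rule poly_mapping_eqI)
    fix w
    have "w \<in> S \<longrightarrow> 1 \<le> Poly_Mapping.lookup u w"
      using assms(2) by (auto simp: in_keys_iff Suc_le_eq)
    then show "Poly_Mapping.lookup (u - e + e) w = Poly_Mapping.lookup u w"
      by (simp add: lookup_add lookup_minus e_def lookup_sum_single del: One_nat_def)
  qed
  then have "Poly_Mapping.single u c = Poly_Mapping.single (u - e) c * (\<Prod>v\<in>S. var v)"
    by (simp add: prod_var mult_single e_def)
  then show ?thesis
    using assms(1) unfolding edge_ideal_def
    by (simp add: ring_module.span_base ring_module.span_scale)
qed

text \<open>The decomposition into primes generated by covers. If \<open>u\<close> is a monomial of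
  \<open>f\<close>, the variables absent from \<open>u\<close> have weight 0 on it, so they do not
  form a cover; the edge they miss lies in the support of \<open>u\<close>, and the monomial is a
  multiple of that generator.\<close>

lemma mem_edge_ideal_iff:
  fixes f :: "('v::finite, 'k::comm_ring_1) mpoly"
  shows "f \<in> edge_ideal H \<longleftrightarrow> (\<forall>C. is_cover H C \<longrightarrow> f \<in> weight_ideal C 1)"
proof (intro iffI allI impI)
  fix C
  assume f: "f \<in> edge_ideal H" and C: "is_cover H C"
  have "edge_ideal H \<subseteq> (weight_ideal C 1 :: ('v, 'k) mpoly set)"
    unfolding edge_ideal_def
    by (rule ring_module.span_minimal[OF _ is_ideal_weight_ideal])
      (use C in \<open>auto simp only: prod_var_mem_weight_ideal_iff is_cover_def\<close>)
  then show "f \<in> weight_ideal C 1" using f by blast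
next
  assume f: "\<forall>C. is_cover H C \<longrightarrow> f \<in> weight_ideal C 1"
  have "Poly_Mapping.single u (Poly_Mapping.lookup f u) \<in> edge_ideal H"
    if u: "u \<in> Poly_Mapping.keys f" for u
  proof -
    have "monomial_weight (- Poly_Mapping.keys u) u = 0"
      unfolding monomial_weight_def by (rule sum.neutral) (simp add: in_keys_iff)
    then have "f \<notin> weight_ideal (- Poly_Mapping.keys u) 1"
      using u unfolding weight_ideal_def by fastforce
    then obtain S where "S \<in> H" "S \<subseteq> Poly_Mapping.keys u"
      using f unfolding is_cover_def by blast
    then show ?thesis by (rule single_mem_edge_ideal)
  qed
  then have "(\<Sum>u\<in>Poly_Mapping.keys f. Poly_Mapping.single u (Poly_Mapping.lookup f u))
      \<in> edge_ideal H"
    by (rule ring_module.subspace_sum[OF is_ideal_edge_ideal])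
  then show "f \<in> edge_ideal H" by (simp add: sum_single_keys)
qed

section \<open>Minimal covers, associated primes and symbolic powers\<close>

lemma is_cover_minimal:
  fixes C :: "'v::finite set"
  assumes "is_cover H C"
  obtains D where "D \<subseteq> C" "is_cover H D" "\<And>D'. D' \<subseteq> D \<Longrightarrow> is_cover H D' \<Longrightarrow> D' = D"
proof -
  have "\<exists>D\<in>{D. is_cover H D}. D \<subseteq> C \<and> (\<forall>D'\<in>{D. is_cover H D}. D' \<subseteq> D \<longrightarrow> D = D')"
    by (rule finite_has_minimal2) (use assms in auto)
  then show thesis using that by blast
qed

text \<open>For a minimal cover \<open>C\<close>, the ideal generated by its variables is the annihilator of the
  product of all the other variables.\<close>

lemma weight_ideal_mem_Ass:
  fixes C :: "'v::{finite, linorder} set"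
  assumes C: "is_cover H C" and minimal: "\<And>D. D \<subseteq> C \<Longrightarrow> is_cover H D \<Longrightarrow> D = C"
  shows "(weight_ideal C 1 :: ('v, 'k::idom) mpoly set) \<in> Ass (edge_ideal H)"
proof -
  define b :: "('v, 'k) mpoly" where "b = (\<Prod>v\<in>-C. var v)"
  have b: "b \<in> weight_ideal D 1 \<longleftrightarrow> \<not> D \<subseteq> C" for D
    unfolding b_def prod_var_mem_weight_ideal_iff by blast
  have "a * b \<in> edge_ideal H" if a: "a \<in> weight_ideal C 1" for a
    unfolding mem_edge_ideal_iff
  proof (intro allI impI)
    fix D
    assume D: "is_cover H D"
    \<comment> \<open>Either \<open>D\<close> is contained in \<open>C\<close>, hence equal to it,
      and \<open>a\<close> qualifies, or \<open>D\<close> contains a variable dividing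
      \<open>b\<close>.\<close>
    have "a \<in> weight_ideal D 1 \<or> b \<in> weight_ideal D 1"
      using minimal[OF _ D] a b by blast
    then show "a * b \<in> weight_ideal D 1"
      using ring_module.subspace_scale[OF is_ideal_weight_ideal] by (metis mult.commute)
  qed
  moreover have "a \<in> weight_ideal C 1" if "a * b \<in> edge_ideal H" for a
  proof -
    have "a * b \<in> weight_ideal C 1" using that C unfolding mem_edge_ideal_iff by blast
    then show ?thesis
      using prime_ideal_weight_ideal[of C] b[of C] unfolding prime_ideal_def by blast
  qed
  ultimately show ?thesis
    using prime_ideal_weight_ideal unfolding Ass_def by blast
qed

text \<open>Pass to a minimal cover \<open>D\<close> inside \<open>C\<close>, whose prime is
  associated. A multiplier \<open>s\<close> outside this prime has valuation 0, so
  \<open>s * f\<close> and \<open>f\<close> have the same valuation on \<open>D\<close>; enlarging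
  \<open>D\<close> to \<open>C\<close> only raises weights.\<close>

lemma symbolic_power_edge_ideal_subset:
  fixes C :: "'v::{finite, linorder} set"
  assumes "is_cover H C"
  shows "symbolic_power (edge_ideal H) m \<subseteq> (weight_ideal C m :: ('v, 'k::idom) mpoly set)"
proof
  fix f :: "('v, 'k) mpoly"
  assume f: "f \<in> symbolic_power (edge_ideal H) m"
  obtain D where D: "D \<subseteq> C" "is_cover H D" "\<And>D'. D' \<subseteq> D \<Longrightarrow> is_cover H D' \<Longrightarrow> D' = D"
    using is_cover_minimal[OF assms] by blast
  obtain s where s: "s \<notin> weight_ideal D 1" "s * f \<in> ideal_power (edge_ideal H) m"
    using f weight_ideal_mem_Ass[OF D(2,3)] unfolding mem_symbolic_power_iff by blast
  have "edge_ideal H \<subseteq> weight_ideal D 1"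
    using D(2) mem_edge_ideal_iff by blast
  then have sf: "s * f \<in> weight_ideal D m"
    using s(2) ideal_power_subset_weight_ideal by blast
  have "f \<in> weight_ideal D m"
  proof (cases m)
    case 0
    then show ?thesis by (simp add: weight_ideal_def)
  next
    case (Suc m')
    then show ?thesis
      using mult_notin_weight_ideal[of s D 0 f m'] s(1) sf by auto
  qed
  moreover have "monomial_weight D u \<le> monomial_weight C u" for u
    unfolding monomial_weight_def using D(1) by (intro sum_mono2) auto
  ultimately show "f \<in> weight_ideal C m"
    unfolding weight_ideal_def using order_trans by blast
qed

text \<open>If \<open>P = (I : b)\<close> is associated to the radical ideal \<open>I\<close>, then \<open>b \<notin> P\<close>, so every variable in
  \<open>P\<close> lies in \<open>I\<close> after localising at \<open>P\<close>.\<close>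

lemma prod_var_power_mem_symbolic_power:
  fixes H :: "'v::{finite, linorder} set set"
  assumes covers: "\<And>C. is_cover H C \<Longrightarrow> c \<le> card C" and m: "m \<le> c * k"
  shows "((\<Prod>v\<in>UNIV. var v) ^ k :: ('v, 'k::idom) mpoly) \<in> symbolic_power (edge_ideal H) m"
  unfolding mem_symbolic_power_iff
proof
  fix P :: "('v, 'k) mpoly set"
  assume "P \<in> Ass (edge_ideal H)"
  then obtain b where P: "prime_ideal P" and b: "P = {a. a * b \<in> edge_ideal H}"
    unfolding Ass_def by blast
  have "1 \<notin> P" using prime_ideal_prod[OF P, of "{}"] by simp
  then have "b \<notin> edge_ideal H" using b by simp
  \<comment> \<open>The prime of some cover misses \<open>b\<close>, hence also
    \<open>b * b\<close>.\<close>
  then have "b * b \<notin> edge_ideal H"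
    using prime_ideal_weight_ideal unfolding mem_edge_ideal_iff prime_ideal_def by blast
  then have b_notin: "b \<notin> P" using b by simp
  define C where "C = {v. var v \<in> P}"
  have "is_cover H C"
    unfolding is_cover_def
  proof
    fix S
    assume "S \<in> H"
    then have "b * (\<Prod>v\<in>S. var v) \<in> edge_ideal H"
      unfolding edge_ideal_def by (intro ring_module.span_scale ring_module.span_base) blast
    then have "(\<Prod>v\<in>S. var v) \<in> P" using b by (simp add: mult.commute)
    then show "S \<inter> C \<noteq> {}"
      using prime_ideal_prod[OF P, of S var] unfolding C_def by fastforce
  qed
  then have card: "m \<le> card (C \<times> {..<k})"
    using m covers[of C] by (simp add: card_cartesian_product) (meson le_trans mult_le_mono1)
  \<comment> \<open>For each \<open>v\<close> in \<open>C\<close> take \<open>k\<close> copies of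
    \<open>var v * b\<close>, which lies in the ideal by the choice of \<open>b\<close>; this gives
    at least \<open>c * k\<close> factors.\<close>
  have "(\<Prod>(v, i)\<in>C \<times> {..<k}. var v * b) \<in> ideal_power (edge_ideal H) m"
    by (rule prod_mem_ideal_power[OF is_ideal_edge_ideal _ _ card]) (auto simp: C_def b)
  moreover have "(\<Prod>(v, i)\<in>C \<times> {..<k}. var v * b) = (\<Prod>v\<in>C. var v) ^ k * b ^ (card C * k)"
    by (simp add: prod.cartesian_product[symmetric] prod.distrib power_mult_distrib
        ac_simps flip: prod_power_distrib power_mult)
  \<comment> \<open>The variables outside \<open>C\<close> complete the product to all vertices, and
    the power of \<open>b\<close> is left as the multiplier outside \<open>P\<close>.\<close>
  ultimately have "(\<Prod>v\<in>-C. var v) ^ k * ((\<Prod>v\<in>C. var v) ^ k * b ^ (card C * k))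
      \<in> ideal_power (edge_ideal H) m"
    unfolding ideal_power_def by (simp only: ring_module.span_scale)
  moreover have "(\<Prod>v\<in>UNIV. var v) = (\<Prod>v\<in>-C. var v) * (\<Prod>v\<in>C. var v :: ('v, 'k) mpoly)"
    using prod.subset_diff[of C UNIV var] by (simp add: Compl_eq_Diff_UNIV)
  then have "b ^ (card C * k) * (\<Prod>v\<in>UNIV. var v) ^ k =
      (\<Prod>v\<in>-C. var v) ^ k * ((\<Prod>v\<in>C. var v) ^ k * b ^ (card C * k))"
    by (simp only: power_mult_distrib ac_simps)
  ultimately have "b ^ (card C * k) * (\<Prod>v\<in>UNIV. var v) ^ k \<in> ideal_power (edge_ideal H) m"
    by (simp only:)
  moreover have "b ^ (card C * k) \<notin> P"
    using prime_ideal_power[OF P b_notin] .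
  ultimately show "\<exists>s. s \<notin> P \<and> s * (\<Prod>v\<in>UNIV. var v) ^ k \<in> ideal_power (edge_ideal H) m"
    by blast
qed

section \<open>Waldschmidt constants\<close>

lemma monom_degree_eq_monomial_weight:
  fixes u :: "'v::finite \<Rightarrow>\<^sub>0 nat"
  shows "monom_degree u = monomial_weight UNIV u"
  unfolding monom_degree_def monomial_weight_def
  by (rule sum.mono_neutral_left) (auto simp: in_keys_iff)

lemma homogeneous_mult:
  fixes f g :: "('v::finite, 'k::comm_ring_1) mpoly"
  assumes "homogeneous d f" "homogeneous e g"
  shows "homogeneous (d + e) (f * g)"
  using assms keys_mult[of f g]
  unfolding homogeneous_def monom_degree_eq_monomial_weight
  by (fastforce simp: monomial_weight_add)

lemma homogeneous_prod_var:
  fixes S :: "'v::finite set"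
  shows "homogeneous (card S) (\<Prod>v\<in>S. var v :: ('v, 'k::comm_ring_1) mpoly)"
  by (simp add: homogeneous_def prod_var monom_degree_eq_monomial_weight monomial_weight_def
      lookup_sum_single sum.If_cases del: One_nat_def)

lemma homogeneous_power:
  fixes f :: "('v::finite, 'k::comm_ring_1) mpoly"
  assumes "homogeneous d f"
  shows "homogeneous (d * k) (f ^ k)"
proof (induction k)
  case 0
  show ?case by (simp add: homogeneous_def monom_degree_def)
next
  case (Suc k)
  show ?case using homogeneous_mult[OF assms Suc] by simp
qed

text \<open>Averaging over \<open>j\<close> the condition that a monomial have weight at least \<open>m\<close> on \<open>D j\<close> bounds its
  total degree.\<close>

lemma initial_degree_symbolic_power_bounds:
  fixes H :: "'v::{finite, linorder} set set" and D :: "'i \<Rightarrow> 'v set"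
  defines "\<alpha> \<equiv> \<lambda>m. initial_degree (symbolic_power (edge_ideal H :: ('v, 'k::field) mpoly set) m)"
  assumes covers: "\<And>C. is_cover H C \<Longrightarrow> c \<le> card C"
    and D: "\<And>j. j \<in> J \<Longrightarrow> is_cover H (D j)" "finite J"
    and uniform: "\<And>v. card {j \<in> J. v \<in> D j} = c"
  shows "m \<le> c * k \<Longrightarrow> \<alpha> m \<le> CARD('v) * k"
    and "0 < c \<Longrightarrow> card J * m \<le> c * \<alpha> m"
proof -
  define Q where "Q m d \<longleftrightarrow> (\<exists>f\<in>symbolic_power (edge_ideal H :: ('v, 'k) mpoly set) m.
    f \<noteq> 0 \<and> homogeneous d f)" for m d
  have \<alpha>: "\<alpha> m = (LEAST d. Q m d)" for m
    unfolding \<alpha>_def initial_degree_def Q_def ..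
  have Q: "Q m (CARD('v) * k)" if "m \<le> c * k" for m k
    unfolding Q_def
  proof (intro bexI conjI)
    show "(\<Prod>v\<in>UNIV. var v) ^ k \<in> symbolic_power (edge_ideal H :: ('v, 'k) mpoly set) m"
      using prod_var_power_mem_symbolic_power[OF covers that] .
    show "homogeneous (CARD('v) * k) ((\<Prod>v\<in>UNIV. var v) ^ k :: ('v, 'k) mpoly)"
      by (intro homogeneous_power homogeneous_prod_var)
    show "(\<Prod>v\<in>UNIV. var v) ^ k \<noteq> (0 :: ('v, 'k) mpoly)"
      by (rule power_not_zero) (simp add: prod_var flip: keys_eq_empty)
  qed
  then show "m \<le> c * k \<Longrightarrow> \<alpha> m \<le> CARD('v) * k"
    unfolding \<alpha> by (blast intro: Least_le)
  show "card J * m \<le> c * \<alpha> m" if "0 < c"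
  proof -
    \<comment> \<open>The least degree is attained: since \<open>m \<le> c * m\<close>, the
      \<open>m\<close>-th power of the product of all variables is a candidate.\<close>
    have "Q m (\<alpha> m)"
      unfolding \<alpha> by (rule LeastI[where P = "Q m", OF Q[of m m]]) (use that in simp)
    then obtain f :: "('v, 'k) mpoly" where f: "f \<in> symbolic_power (edge_ideal H) m"
      "f \<noteq> 0" "homogeneous (\<alpha> m) f"
      unfolding Q_def by blast
    obtain u where u: "u \<in> Poly_Mapping.keys f"
      using f(2) by (metis all_not_in_conv keys_eq_empty)
    have "m \<le> monomial_weight (D j) u" if "j \<in> J" for j
      using symbolic_power_edge_ideal_subset[OF D(1)[OF that]] f(1) u
      unfolding weight_ideal_def by blast
    then have "card J * m \<le> (\<Sum>j\<in>J. monomial_weight (D j) u)"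
      using sum_mono[of J "\<lambda>_. m"] by simp
    also have "\<dots> = (\<Sum>j\<in>J. \<Sum>v\<in>UNIV. if v \<in> D j then Poly_Mapping.lookup u v else 0)"
      unfolding monomial_weight_def by (simp add: sum.If_cases)
    also have "\<dots> = (\<Sum>v\<in>UNIV. \<Sum>j\<in>J. if v \<in> D j then Poly_Mapping.lookup u v else 0)"
      by (rule sum.swap)
    \<comment> \<open>Double counting: each vertex lies in \<open>D j\<close> for exactly
      \<open>c\<close> indices \<open>j\<close>.\<close>
    also have "\<dots> = (\<Sum>v\<in>UNIV. c * Poly_Mapping.lookup u v)"
      using D(2) uniform by (simp flip: sum.inter_filter)
    also have "\<dots> = c * \<alpha> m"
      using f(3) u unfolding homogeneous_def monom_degree_eq_monomial_weight monomial_weight_def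
      by (auto simp flip: sum_distrib_left)
    finally show ?thesis .
  qed
qed

lemma waldschmidt_seq_edge_ideal_tendsto:
  fixes H :: "'v::{finite, linorder} set set" and D :: "'i \<Rightarrow> 'v set"
  assumes "0 < c" and covers: "\<And>C. is_cover H C \<Longrightarrow> c \<le> card C"
    and D: "\<And>j. j \<in> J \<Longrightarrow> is_cover H (D j)" "finite J"
    and uniform: "\<And>v. card {j \<in> J. v \<in> D j} = c"
    and card_J: "card J = CARD('v)"
  shows "waldschmidt_seq (edge_ideal H :: ('v, 'k::field) mpoly set) \<longlonglongrightarrow> CARD('v) / c"
proof (rule tendsto_sandwich)
  let ?\<alpha> = "\<lambda>m. initial_degree (symbolic_power (edge_ideal H :: ('v, 'k) mpoly set) m)"
  let ?n = "CARD('v)"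
  note bounds = initial_degree_symbolic_power_bounds[where 'k = 'k, OF covers D uniform]
  show "\<forall>\<^sub>F m in sequentially. real ?n / c \<le> waldschmidt_seq (edge_ideal H :: ('v, 'k) mpoly set) m"
    using eventually_gt_at_top[of 0]
  proof eventually_elim
    case (elim m)
    have "real ?n * m \<le> c * ?\<alpha> m"
      using bounds(2)[OF _ _ assms(1), of m] card_J by (metis of_nat_le_iff of_nat_mult)
    then show ?case
      using elim assms(1) by (simp add: waldschmidt_seq_def field_simps)
  qed
  show "\<forall>\<^sub>F m in sequentially. waldschmidt_seq (edge_ideal H :: ('v, 'k) mpoly set) m
      \<le> real ?n / c + real ?n / real m"
    using eventually_gt_at_top[of 0]
  proof eventually_elim
    case (elim m)
    \<comment> \<open>This \<open>k\<close> satisfies \<open>m \<le> c * k\<close> whether or not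
      \<open>c\<close> divides \<open>m\<close>; the overshoot costs at most \<open>n / m\<close>,
      which vanishes in the limit.\<close>
    define k where "k = m div c + 1"
    have "m mod c < c" using assms(1) by simp
    then have "m \<le> c * k"
      using mult_div_mod_eq[of c m] unfolding k_def distrib_left mult_1_right by linarith
    then have "real (?\<alpha> m) \<le> ?n * real k"
      using bounds(1)[of m k] by (metis of_nat_le_iff of_nat_mult)
    also have "real k \<le> m / c + 1"
      unfolding k_def using of_nat_div_le_of_nat[of m c, where ?'a = real] by simp
    finally have "real (?\<alpha> m) / m \<le> ?n * (m / c + 1) / m"
      by (simp add: mult_left_mono divide_right_mono)
    also have "\<dots> = real ?n / c + real ?n / real m"
      using elim by (simp add: distrib_left add_divide_distrib)
    finally show ?case by (simp only: waldschmidt_seq_def)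
  qed
  have "(\<lambda>m. real ?n / c + real ?n / real m) \<longlonglongrightarrow> real ?n / c + 0"
    by (intro tendsto_add tendsto_const lim_const_over_n)
  then show "(\<lambda>m. real ?n / c + real ?n / real m) \<longlonglongrightarrow> real ?n / c" by simp
qed simp
section \<open>Paths in a cycle\<close>

text \<open>The vertices of a path are distinct, so the product along the list is the product over
  its set.\<close>

lemma path_ideal_eq_edge_ideal:
  "(path_ideal t E :: ('v, 'k::field) mpoly set) =
    edge_ideal {set vs | vs. is_path E vs \<and> length vs = t}"
proof -
  have "prod_list (map var vs) = (\<Prod>v\<in>set vs. var v :: ('v, 'k) mpoly)" if "is_path E vs" for vs
    using that unfolding is_path_def by (simp add: prod.distinct_set_conv_list)
  then have "{prod_list (map var vs) :: ('v, 'k) mpoly | vs. is_path E vs \<and> length vs = t}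
      = (\<lambda>S. \<Prod>v\<in>S. var v) ` {set vs | vs. is_path E vs \<and> length vs = t}"
    by (auto simp: image_iff) metis+
  then show ?thesis unfolding path_ideal_def edge_ideal_def by simp
qed

section \<open>Vertices of the cycle indexed modulo \<open>n\<close>\<close>

locale cycle_labelling =
  fixes n :: nat and x :: "nat \<Rightarrow> 'v"
  assumes labels: "bij_betw x {1..n} UNIV"
begin

text \<open>Indices start at 0 and run through all naturals, so that arcs may wrap around without
  case distinctions.\<close>

definition cyc :: "nat \<Rightarrow> 'v" where
  "cyc j = x (j mod n + 1)"

definition arc :: "nat \<Rightarrow> nat \<Rightarrow> 'v set" where
  "arc l j = cyc ` {j..<j + l}"

lemma n_pos: "0 < n"
  using labels by (cases n) (auto simp: bij_betw_def)

text \<open>Congruence modulo \<open>n\<close> as an additive equation over the naturals, which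
  avoids truncated subtraction.\<close>

lemma cyc_eq_iff: "cyc i = cyc j \<longleftrightarrow> (\<exists>a b. i + n * a = j + n * b)"
proof -
  have "i mod n + 1 \<in> {1..n}" for i
    using n_pos by (simp add: Suc_leI)
  then have "cyc i = cyc j \<longleftrightarrow> i mod n = j mod n"
    using labels unfolding cyc_def bij_betw_def by (metis add_right_cancel inj_on_eq_iff)
  then show ?thesis using nat_mod_eq_iff by simp
qed

lemma cyc_add_cancel [simp]: "cyc (i + k) = cyc (j + k) \<longleftrightarrow> cyc i = cyc j"
  by (simp add: cyc_eq_iff)

lemma cyc_Suc_cancel [simp]: "cyc (Suc i) = cyc (Suc j) \<longleftrightarrow> cyc i = cyc j"
  by (simp add: cyc_eq_iff)

lemma cyc_add_n [simp]: "cyc (j + n) = cyc j"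
  by (simp add: cyc_def)

lemma cyc_mod [simp]: "cyc (j mod n) = cyc j"
  by (simp add: cyc_def)

lemma cyc_surj: obtains j where "j < n" "v = cyc j"
proof -
  have "v \<in> x ` {1..n}"
    using labels unfolding bij_betw_def by blast
  then obtain i where "i \<in> {1..n}" "v = x i" by blast
  then show thesis
    using that[of "i - 1"] by (auto simp: cyc_def)
qed

text \<open>Two indices in a window of length \<open>n\<close> differ by less than \<open>n\<close>,
  while equal vertices force a multiple of \<open>n\<close>.\<close>

lemma cyc_inj:
  assumes "cyc i = cyc j" "i < k + n" "j < k + n" "k \<le> i" "k \<le> j"
  shows "i = j"
proof -
  have *: "a = b" if "a \<le> b" "b < a + n" "cyc a = cyc b" for a b
  proof -
    obtain p q where "a + n * p = b + n * q" using \<open>cyc a = cyc b\<close> cyc_eq_iff by blast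
    then have "b - a = n * (p - q)"
      using \<open>a \<le> b\<close> by (simp add: diff_mult_distrib2)
    moreover have "b - a < n" using \<open>a \<le> b\<close> \<open>b < a + n\<close> by linarith
    ultimately have "p - q = 0" by (cases "p - q") auto
    then show "a = b" using \<open>b - a = n * (p - q)\<close> \<open>a \<le> b\<close> by simp
  qed
  show ?thesis
    using *[of i j] *[of j i] assms by (cases "i \<le> j") auto
qed

lemma card_vertices: "card (UNIV :: 'v set) = n"
  using bij_betw_same_card[OF labels] by simp

lemma cycle_edges_iff:
  "{u, v} \<in> cycle_edges n x \<longleftrightarrow> (\<exists>j. {u, v} = {cyc j, cyc (Suc j)})"
proof
  assume "{u, v} \<in> cycle_edges n x"
  then obtain i where i: "i \<in> {1..n}" "{u, v} = {x i, x (i mod n + 1)}"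
    unfolding cycle_edges_def by blast
  then have "x i = cyc (i - 1)" "x (i mod n + 1) = cyc (Suc (i - 1))"
    by (auto simp: cyc_def)
  then show "\<exists>j. {u, v} = {cyc j, cyc (Suc j)}" using i by metis
next
  assume "\<exists>j. {u, v} = {cyc j, cyc (Suc j)}"
  then obtain j where j: "{u, v} = {cyc j, cyc (Suc j)}" by blast
  have "j mod n + 1 \<in> {1..n}"
    using n_pos by (simp add: Suc_leI)
  moreover have "{cyc j, cyc (Suc j)} = {x (j mod n + 1), x ((j mod n + 1) mod n + 1)}"
    by (simp add: cyc_def mod_Suc_eq)
  ultimately show "{u, v} \<in> cycle_edges n x"
    unfolding cycle_edges_def j by (intro CollectI exI conjI)
qed

text \<open>The predecessor of \<open>i\<close> is written \<open>i + n - 1\<close>, which does not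
  truncate at \<open>i = 0\<close>.\<close>

lemma adjacent_cyc:
  assumes "{v, cyc i} \<in> cycle_edges n x"
  shows "v = cyc (Suc i) \<or> v = cyc (i + n - 1)"
proof -
  obtain j where "{v, cyc i} = {cyc j, cyc (Suc j)}"
    using assms cycle_edges_iff by blast
  then consider "v = cyc (Suc j)" "cyc i = cyc j" | "v = cyc j" "cyc i = cyc (Suc j)"
    by (auto simp: doubleton_eq_iff)
  then show ?thesis
  proof cases
    case 1
    then show ?thesis by simp
  next
    case 2
    have "cyc (Suc (i + n - 1)) = cyc (Suc j)"
      using 2 n_pos by simp
    then show ?thesis using 2 by simp
  qed
qed

section \<open>Paths of the cycle are arcs\<close>

lemma arc_Suc: "arc (Suc l) j = insert (cyc (j + l)) (arc l j)"
  by (simp add: arc_def atLeastLessThanSuc)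

lemma arc_shift: "arc l (j + n) = arc l j"
proof -
  have "{j + n..<j + n + l} = (\<lambda>i. i + n) ` {j..<j + l}"
    by (simp add: ac_simps)
  then show ?thesis unfolding arc_def by (simp only: image_image cyc_add_n)
qed

lemma arc_Suc_left: "arc (Suc l) (j + n - 1) = insert (cyc (j + n - 1)) (arc l j)"
proof -
  have "{j + n - 1..<j + n - 1 + Suc l} = insert (j + n - 1) {j + n..<j + n + l}"
    using n_pos by auto
  then show ?thesis using arc_shift[of l j] unfolding arc_def by simp
qed

text \<open>The induction must also record that the head is an end of the arc: a vertex put in front
  is a neighbour of that end and is not on the arc yet, so it prolongs the arc at one of its two
  ends.\<close>

lemma set_path_eq_arc:
  assumes "is_path (cycle_edges n x) vs" "vs \<noteq> []"
  shows "\<exists>j. set vs = arc (length vs) j \<and> (hd vs = cyc j \<or> hd vs = cyc (j + length vs - 1))"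
  using assms
proof (induction vs)
  case Nil
  then show ?case by simp
next
  case (Cons v ws)
  show ?case
  proof (cases "ws = []")
    case True
    obtain j where "v = cyc j" using cyc_surj by blast
    then show ?thesis using True by (auto simp: arc_def)
  next
    case False
    define l where "l = length ws"
    have "0 < l" using False by (simp add: l_def)
    have v: "v \<notin> set ws" "{v, hd ws} \<in> cycle_edges n x" "is_path (cycle_edges n x) ws"
      using Cons.prems False by (auto simp: is_path_def successively_Cons)
    then obtain j where j: "set ws = arc l j" "hd ws = cyc j \<or> hd ws = cyc (j + l - 1)"
      using Cons.IH False unfolding l_def by blast
    have notin: "v \<noteq> cyc i" if "j \<le> i" "i < j + l" for i
      using v(1) that unfolding j(1) arc_def by auto
    have "v = cyc (j + l) \<or> v = cyc (j + n - 1)"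
    proof (cases "hd ws = cyc j")
      case True
      then have "v = cyc (Suc j) \<or> v = cyc (j + n - 1)"
        using v(2) adjacent_cyc by simp
      \<comment> \<open>For longer arcs \<open>Suc j\<close> is already occupied; for
        \<open>l = 1\<close> it is the extension at the right end.\<close>
      moreover have "l = 1" if "v = cyc (Suc j)"
        using notin[of "Suc j"] that \<open>0 < l\<close> by (cases "l = 1") auto
      ultimately show ?thesis by auto
    next
      case False
      then have hd: "hd ws = cyc (j + l - 1)" and "l \<noteq> 1" using j(2) by auto
      then have "v = cyc (Suc (j + l - 1)) \<or> v = cyc ((j + l - 1) + n - 1)"
        using v(2) adjacent_cyc by simp
      moreover have "(j + l - 1) + n - 1 = (j + l - 2) + n"
        using \<open>l \<noteq> 1\<close> \<open>0 < l\<close> by simp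
      ultimately have "v = cyc (j + l) \<or> v = cyc (j + l - 2)"
        using \<open>0 < l\<close> by auto
      \<comment> \<open>The left neighbour \<open>j + l - 2\<close> of the right end is on the arc
        because \<open>l\<close> is at least 2.\<close>
      then show ?thesis
        using notin[of "j + l - 2"] \<open>l \<noteq> 1\<close> \<open>0 < l\<close> by auto
    qed
    then show ?thesis
    proof
      assume "v = cyc (j + l)"
      then show ?thesis
        using j(1) by (intro exI[of _ j]) (simp add: arc_Suc flip: l_def)
    next
      assume "v = cyc (j + n - 1)"
      then show ?thesis
        using j(1) by (intro exI[of _ "j + n - 1"]) (simp add: arc_Suc_left del: One_nat_def flip: l_def)
    qed
  qed
qed

lemma is_path_arc:
  assumes "l \<le> n"
  shows "is_path (cycle_edges n x) (map cyc [j..<j + l])"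
proof -
  have "inj_on cyc {j..<j + l}"
    by (rule inj_onI) (use cyc_inj[where k = j] assms in auto)
  then have "distinct (map cyc [j..<j + l])"
    by (simp add: distinct_map)
  moreover have "successively (\<lambda>u v. {u, v} \<in> cycle_edges n x) (map cyc [j..<j + l])"
    unfolding successively_conv_nth using cycle_edges_iff by auto
  ultimately show ?thesis unfolding is_path_def by blast
qed

lemma path_ideal_cycle:
  assumes "0 < t" "t \<le> n"
  shows "path_ideal t (cycle_edges n x) = edge_ideal (range (arc t))"
proof -
  have "{set vs | vs. is_path (cycle_edges n x) vs \<and> length vs = t} = range (arc t)"
  proof safe
    fix vs
    assume "is_path (cycle_edges n x) vs" "t = length vs"
    then show "set vs \<in> range (arc (length vs))"
      using set_path_eq_arc[of vs] assms by auto
  next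
    fix j
    show "\<exists>vs. arc t j = set vs \<and> is_path (cycle_edges n x) vs \<and> length vs = t"
      using is_path_arc[OF assms(2), of j]
      by (intro exI[of _ "map cyc [j..<j + t]"]) (simp add: arc_def)
  qed
  then show ?thesis by (simp add: path_ideal_eq_edge_ideal)
qed

section \<open>Covers of the arcs and their rotations\<close>

lemma card_cover_arcs:
  assumes C: "is_cover (range (arc t)) C" and "t \<le> n"
  shows "n \<le> card C * t"
proof -
  define idx where "idx v = (SOME i. cyc i = v)" for v
  have idx: "cyc (idx v) = v" for v
    unfolding idx_def by (rule someI_ex) (metis cyc_surj)
  \<comment> \<open>The arc starting at \<open>v\<close> meets \<open>C\<close> in some
    \<open>w\<close> at an offset \<open>i < t\<close>, and going back \<open>i\<close> steps from
    \<open>w\<close> recovers \<open>v\<close>. Going back is done as \<open>n - i\<close> steps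
    forward, so \<open>C \<times> {..<t}\<close> maps onto the vertices.\<close>
  have "v \<in> (\<lambda>(w, i). cyc (idx w + (n - i))) ` (C \<times> {..<t})" for v
  proof -
    obtain j where j: "v = cyc j" using cyc_surj by blast
    obtain w where "w \<in> C" "w \<in> arc t j"
      using C unfolding is_cover_def by blast
    then obtain i where i: "i < t" "cyc (j + i) \<in> C"
      unfolding arc_def by (auto simp: le_iff_add)
    have "cyc (idx (cyc (j + i)) + (n - i)) = cyc ((j + i) + (n - i))"
      using idx by simp
    also have "\<dots> = v"
      using i(1) assms(2) j by simp
    finally show ?thesis using i by force
  qed
  then have "UNIV \<subseteq> (\<lambda>(w, i). cyc (idx w + (n - i))) ` (C \<times> {..<t})" by blast
  moreover have "finite C"
    using card_vertices n_pos by (metis card_ge_0_finite rev_finite_subset subset_UNIV)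
  ultimately have "card (UNIV :: 'v set) \<le> card (C \<times> {..<t})"
    by (meson finite_SigmaI finite_lessThan surj_card_le)
  then show ?thesis by (simp add: card_vertices card_cartesian_product)
qed

definition spaced_set :: "nat \<Rightarrow> nat \<Rightarrow> nat \<Rightarrow> 'v set" where
  "spaced_set t c s = (\<lambda>i. cyc (s + t * i)) ` {..<c}"

text \<open>Measured from \<open>s\<close>, the arc starts at \<open>p\<close>. The first multiple
  of \<open>t\<close> from \<open>p\<close> on, namely \<open>t * i\<close> with \<open>i\<close>
  the ceiling of \<open>p / t\<close>, is fewer than \<open>t\<close> steps away.\<close>

lemma is_cover_spaced_set:
  assumes "0 < t" "0 < c" "n \<le> t * c" "s < n"
  shows "is_cover (range (arc t)) (spaced_set t c s)"
proof -
  have "\<exists>a\<in>{j..<j + t}. \<exists>i<c. cyc a = cyc (s + t * i)" for j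
  proof -
    define p where "p = (j + (n - s)) mod n"
    define k where "k = (j + (n - s)) div n"
    have "p < n" using n_pos by (simp add: p_def)
    have pk: "p + n * k = j + (n - s)" by (simp add: p_def k_def)
    define i where "i = (p + (t - 1)) div t"
    have "t * i + (p + (t - 1)) mod t = p + (t - 1)" by (simp add: i_def)
    moreover have "(p + (t - 1)) mod t < t" using assms(1) by simp
    ultimately have i: "p \<le> t * i" "t * i < p + t" by linarith+
    show ?thesis
    proof (cases "i < c")
      case True
      have "(j + (t * i - p)) + n * 1 = (s + t * i) + n * k"
        using pk i assms(4) by simp
      then have "cyc (j + (t * i - p)) = cyc (s + t * i)"
        unfolding cyc_eq_iff by blast
      moreover have "j + (t * i - p) \<in> {j..<j + t}" using i by auto
      ultimately show ?thesis using True by blast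
    next
      \<comment> \<open>That multiple is now at least \<open>n\<close>, so the arc runs past the end
        of the turn and contains \<open>cyc s\<close> at offset \<open>n - p\<close>.\<close>
      case False
      then have "t * c \<le> t * i" by simp
      then have "n < p + t" using i(2) assms(3) by linarith
      have "(j + (n - p)) + n * 0 = (s + t * 0) + n * k"
        using pk \<open>p < n\<close> assms(4) by simp
      then have "cyc (j + (n - p)) = cyc (s + t * 0)"
        unfolding cyc_eq_iff by blast
      moreover have "j + (n - p) \<in> {j..<j + t}" using \<open>p < n\<close> \<open>n < p + t\<close> by auto
      ultimately show ?thesis using assms(2) by blast
    qed
  qed
  then show ?thesis
    unfolding is_cover_def arc_def spaced_set_def by fastforce
qed

text \<open>Each \<open>i < c\<close> puts \<open>v\<close> at the \<open>i\<close>-th place of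
  exactly one rotation \<open>h i\<close>, and distinct \<open>i\<close> give distinct rotations
  because the numbers \<open>t * i\<close> are distinct and below \<open>n\<close>.\<close>

lemma card_spaced_sets:
  assumes "0 < t" "\<And>i. i < c \<Longrightarrow> t * i < n"
  shows "card {s \<in> {..<n}. v \<in> spaced_set t c s} = c"
proof -
  obtain a where a: "v = cyc a" using cyc_surj by blast
  \<comment> \<open>This is \<open>a - t * i\<close> modulo \<open>n\<close>, shifted by
    \<open>n\<close> to stay nonnegative.\<close>
  define h where "h i = (a + (n - t * i)) mod n" for i
  have cyc_h: "cyc (h i) = cyc (a + (n - t * i))" for i
    by (simp add: h_def)
  have h: "v = cyc (s + t * i) \<longleftrightarrow> s = h i" if "i < c" "s < n" for s i
  proof -
    have "v = cyc (s + t * i) \<longleftrightarrow> cyc ((a + (n - t * i)) + t * i) = cyc (s + t * i)"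
      using a assms(2)[OF \<open>i < c\<close>] by simp
    also have "\<dots> \<longleftrightarrow> cyc (h i) = cyc s" by (simp only: cyc_add_cancel cyc_h)
    also have "\<dots> \<longleftrightarrow> s = h i"
      using cyc_inj[of "h i" s 0] \<open>s < n\<close> n_pos by (auto simp: h_def)
    finally show ?thesis .
  qed
  have "inj_on h {..<c}"
  proof (rule inj_onI)
    fix i i'
    assume ii': "i \<in> {..<c}" "i' \<in> {..<c}" "h i = h i'"
    have "h i < n" using n_pos by (simp add: h_def)
    then have "cyc (t * i + h i) = cyc (t * i' + h i)"
      using h[of i "h i"] h[of i' "h i"] ii' by (metis add.commute lessThan_iff)
    then have "cyc (t * i) = cyc (t * i')" by simp
    then have "t * i = t * i'"
      using cyc_inj[of "t * i" "t * i'" 0] assms(2) ii' by simp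
    then show "i = i'" using assms(1) by simp
  qed
  moreover have "{s \<in> {..<n}. v \<in> spaced_set t c s} = h ` {..<c}"
  proof (intro equalityI subsetI)
    fix s
    assume "s \<in> {s \<in> {..<n}. v \<in> spaced_set t c s}"
    then show "s \<in> h ` {..<c}"
      using h unfolding spaced_set_def by blast
  next
    fix s
    assume "s \<in> h ` {..<c}"
    then obtain i where "i < c" "s = h i" by blast
    moreover have "h i < n" using n_pos by (simp add: h_def)
    ultimately show "s \<in> {s \<in> {..<n}. v \<in> spaced_set t c s}"
      using h[of i s] unfolding spaced_set_def by blast
  qed
  ultimately show ?thesis by (simp add: card_image)
qed

end

theorem proposition4p7:
  fixes n t q r :: nat
    and x :: "nat \<Rightarrow> 'v::{finite, linorder}"
    and I :: "('v, 'k::field) mpoly set"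
  assumes vertices: "bij_betw x {1..n} (UNIV :: 'v set)"
    and t: "2 \<le> t" "t \<le> n"
    and division: "n = t * q + r" "r < t"
    and I_def: "I = path_ideal t (cycle_edges n x)"
  shows "convergent (waldschmidt_seq I) \<and>
    waldschmidt_constant I = (if r = 0 then real t else real n / real (q + 1))"
proof -
  interpret cycle_labelling n x by unfold_locales (rule vertices)
  \<comment> \<open>The ceiling of \<open>n / t\<close>: \<open>upper\<close> makes the spaced sets
    covers, and \<open>lower\<close> gives both the minimal size of a cover and the distinctness of
    the rotations.\<close>
  define c where "c = (if r = 0 then q else q + 1)"
  have upper: "n \<le> t * c"
    using division by (simp add: c_def)
  have lower: "t * i < n" if "i < c" for i
  proof (cases "r = 0")
    case True
    then have "t * i < t * q" using that t by (simp add: c_def)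
    then show ?thesis using division(1) by linarith
  next
    case False
    then have "t * i \<le> t * q" using that by (simp add: c_def)
    then show ?thesis using division(1) False by linarith
  qed
  have "0 < c" using upper n_pos by (cases c) auto
  have "0 < t" using t by simp
  have "waldschmidt_seq (edge_ideal (range (arc t)) :: ('v, 'k) mpoly set)
      \<longlonglongrightarrow> real CARD('v) / real c"
  proof (rule waldschmidt_seq_edge_ideal_tendsto[where J = "{..<n}" and D = "spaced_set t c"])
    \<comment> \<open>A cover with fewer than \<open>c\<close> vertices would have
      \<open>t * card C < n\<close> by \<open>lower\<close>, against the incidence count.\<close>
    show "c \<le> card C" if "is_cover (range (arc t)) C" for C
      using lower[of "card C"] card_cover_arcs[OF that t(2)]
      by (metis mult.commute not_less)
    show "is_cover (range (arc t)) (spaced_set t c s)" if "s \<in> {..<n}" for s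
      using is_cover_spaced_set \<open>0 < t\<close> \<open>0 < c\<close> upper that by simp
    show "card {s \<in> {..<n}. v \<in> spaced_set t c s} = c" for v
      using card_spaced_sets \<open>0 < t\<close> lower .
  qed (use \<open>0 < c\<close> card_vertices in simp_all)
  moreover have "I = edge_ideal (range (arc t))"
    unfolding I_def by (rule path_ideal_cycle[OF \<open>0 < t\<close> t(2)])
  ultimately have "waldschmidt_seq I \<longlonglongrightarrow> real n / real c"
    by (simp add: card_vertices)
  moreover have "real n / real c = (if r = 0 then real t else real n / real (q + 1))"
    using division \<open>0 < c\<close> by (auto simp: c_def split: if_splits)
  ultimately show ?thesis
    unfolding waldschmidt_constant_def using limI convergentI by metis
qed

end
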